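(* Let $T: B(\ell^2)\to B(\ell^2)$ be a linear bijection. Then $T$ is completely contractive and Schur multiplicative if and only if there are permutation unitaries $u,v$ in $B(\ell^2)$ such that $T(a)=uav$ for all $a\in B(\ell^2)$. In particular, every completely contractive Schur multiplicative linear bijection on $B(\ell^2)$ is a complete isometry.
   Context: $B(\ell^2)$ is the space of bounded linear operators on the complex Hilbert space $\ell^2=\ell^2(\mathbb{N})$, with the operator norm and its usual operator space structure ($M_k(B(\ell^2))$ is normed as the operators on the $k$-fold direct sum of $\ell^2$). Using the canonical orthonormal basis $\{e_i\}_{i=1}^\infty$, each $a\in B(\ell^2)$ is identified with the infinite matrix $[a_{ij}]_{i,j\in\mathbb{N}}$, $a_{ij}=(ae_j,e_i)$. The Schur product of $a,b\in B(\ell^2)$ is the operator $a\ast b\in B(\ell^2)$ with matrix $[a_{ij}b_{ij}]$ (it is well known that this is again a bounded operator). A linear map $T$ on $B(\ell^2)$ is Schur multiplicative if $T(a)\ast T(b)=T(a\ast b)$ for all $a,b\in B(\ell^2)$. $T$ is completely contractive (respectively, a complete isometry) if for every positive integer $k$ the amplification $T^{(k)}:M_k(B(\ell^2))\to M_k(B(\ell^2))$, $[x_{rs}]\mapsto[T(x_{rs})]$, has norm at most $1$ (respectively, is an isometry). A permutation unitary in $B(\ell^2)$ is a unitary that permutes the canonical basis, i.e. $ue_i=e_{\pi(i)}$ for all $i$, for some permutation $\pi$ of $\mathbb{N}$. Products such as $uav$ are compositions of operators. *)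

theory Defs
  imports "HOL-Analysis.Analysis"
begin

section \<open>Complex vector spaces\<close>

class complex_vector = real_vector +
  fixes scaleC :: "complex \<Rightarrow> 'a \<Rightarrow> 'a"  (infixr "*\<^sub>C" 75)
  assumes scaleC_add_right: "c *\<^sub>C (x + y) = c *\<^sub>C x + c *\<^sub>C y"
    and scaleC_add_left: "(c + d) *\<^sub>C x = c *\<^sub>C x + d *\<^sub>C x"
    and scaleC_scaleC: "c *\<^sub>C d *\<^sub>C x = (c * d) *\<^sub>C x"
    and scaleC_one: "1 *\<^sub>C x = x"
    and scaleR_scaleC: "r *\<^sub>R x = complex_of_real r *\<^sub>C x"

lemma vector_space_scaleC: "vector_space (scaleC :: complex \<Rightarrow> 'a::complex_vector \<Rightarrow> 'a)"
  by unfold_locales (simp_all add: scaleC_add_right scaleC_add_left scaleC_scaleC scaleC_one)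

abbreviation clinear :: "('a::complex_vector \<Rightarrow> 'b::complex_vector) \<Rightarrow> bool" where
  "clinear \<equiv> Vector_Spaces.linear (*\<^sub>C) (*\<^sub>C)"

lemma clinear_iff:
  "clinear f \<longleftrightarrow> (\<forall>x y. f (x + y) = f x + f y) \<and> (\<forall>c x. f (c *\<^sub>C x) = c *\<^sub>C f x)"
  by (simp add: Vector_Spaces.linear_iff vector_space_scaleC)

section \<open>The Hilbert space of square-summable complex sequences\<close>

typedef ell2 = "{x :: nat \<Rightarrow> complex. summable (\<lambda>i. (cmod (x i))\<^sup>2)}"
  morphisms coord Abs_ell2
  by (rule exI[of _ "\<lambda>_. 0"]) simp

setup_lifting type_definition_ell2

lemma summable_coord: "summable (\<lambda>i. (cmod (coord x i))\<^sup>2)"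
  using coord by simp

lemma ell2_eqI: "(\<And>i. coord x i = coord y i) \<Longrightarrow> x = y"
  using coord_inject by blast

lemma cmod_add_sq_le: "(cmod (a + b))\<^sup>2 \<le> 2 * (cmod a)\<^sup>2 + 2 * (cmod b)\<^sup>2"
proof -
  have "(cmod (a + b))\<^sup>2 \<le> (cmod a + cmod b)\<^sup>2"
    by (intro power_mono norm_triangle_ineq) simp
  also have "\<dots> \<le> 2 * (cmod a)\<^sup>2 + 2 * (cmod b)\<^sup>2"
    using sum_squares_ge_zero[of "cmod a - cmod b" 0] by (simp add: power2_eq_square algebra_simps)
  finally show ?thesis .
qed

lemma summable_sq_add:
  assumes "summable (\<lambda>i. (cmod (x i))\<^sup>2)" "summable (\<lambda>i. (cmod (y i))\<^sup>2)"
  shows "summable (\<lambda>i. (cmod (x i + y i))\<^sup>2)"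
proof (rule summable_comparison_test)
  show "summable (\<lambda>i. 2 * (cmod (x i))\<^sup>2 + 2 * (cmod (y i))\<^sup>2)"
    using assms by (intro summable_add summable_mult)
  show "\<exists>N. \<forall>n\<ge>N. norm ((cmod (x n + y n))\<^sup>2) \<le> 2 * (cmod (x n))\<^sup>2 + 2 * (cmod (y n))\<^sup>2"
    using cmod_add_sq_le by simp
qed

lemma summable_sq_scale:
  "summable (\<lambda>i. (cmod (x i))\<^sup>2) \<Longrightarrow> summable (\<lambda>i. (cmod (c * x i))\<^sup>2)"
  by (simp add: norm_mult power_mult_distrib summable_mult)

lemma summable_sq_prod:
  assumes "summable (\<lambda>i. (cmod (x i))\<^sup>2)" "summable (\<lambda>i. (cmod (y i))\<^sup>2)"
  shows "summable (\<lambda>i. cmod (x i) * cmod (y i))"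
proof (rule summable_comparison_test)
  show "summable (\<lambda>i. (cmod (x i))\<^sup>2 + (cmod (y i))\<^sup>2)"
    using assms by (intro summable_add)
  have "a * b \<le> a\<^sup>2 + b\<^sup>2" if "a \<ge> 0" "b \<ge> 0" for a b :: real
  proof -
    have "2 * (a * b) \<le> a\<^sup>2 + b\<^sup>2" using sum_squares_bound[of a b] by (simp add: mult.assoc)
    moreover have "0 \<le> a * b" using that by simp
    ultimately show ?thesis by linarith
  qed
  then show "\<exists>N. \<forall>n\<ge>N. norm (cmod (x n) * cmod (y n)) \<le> (cmod (x n))\<^sup>2 + (cmod (y n))\<^sup>2"
    by simp
qed

instantiation ell2 :: real_inner
begin

lift_definition zero_ell2 :: ell2 is "\<lambda>_. 0" by simp

lift_definition plus_ell2 :: "ell2 \<Rightarrow> ell2 \<Rightarrow> ell2" is "\<lambda>x y i. x i + y i"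
  by (rule summable_sq_add)

lift_definition uminus_ell2 :: "ell2 \<Rightarrow> ell2" is "\<lambda>x i. - x i" by simp

definition minus_ell2 :: "ell2 \<Rightarrow> ell2 \<Rightarrow> ell2" where "minus_ell2 x y = x + - y"

lift_definition scaleR_ell2 :: "real \<Rightarrow> ell2 \<Rightarrow> ell2" is "\<lambda>r x i. complex_of_real r * x i"
  by (rule summable_sq_scale)

definition inner_ell2 :: "ell2 \<Rightarrow> ell2 \<Rightarrow> real" where
  "inner_ell2 x y = Re (\<Sum>i. coord x i * cnj (coord y i))"

definition norm_ell2 :: "ell2 \<Rightarrow> real" where
  "norm_ell2 x = sqrt (\<Sum>i. (cmod (coord x i))\<^sup>2)"

definition sgn_ell2 :: "ell2 \<Rightarrow> ell2" where "sgn_ell2 x = inverse (norm x) *\<^sub>R x"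

definition dist_ell2 :: "ell2 \<Rightarrow> ell2 \<Rightarrow> real" where "dist_ell2 x y = norm (x - y)"

definition uniformity_ell2 :: "(ell2 \<times> ell2) filter" where
  "uniformity_ell2 = (INF e\<in>{0<..}. principal {(x, y). dist x y < e})"

definition open_ell2 :: "ell2 set \<Rightarrow> bool" where
  "open_ell2 U \<longleftrightarrow> (\<forall>x\<in>U. eventually (\<lambda>(x', y). x' = x \<longrightarrow> y \<in> U) uniformity)"

lemma summable_coord_prod: "summable (\<lambda>i. coord x i * cnj (coord y i))"
  by (rule summable_norm_cancel)
    (simp add: norm_mult summable_sq_prod summable_coord)

lemma inner_ell2_self: "inner x x = (\<Sum>i. (cmod (coord x i))\<^sup>2)" for x :: ell2
proof -
  have "(\<Sum>i. coord x i * cnj (coord x i)) = (\<Sum>i. complex_of_real ((cmod (coord x i))\<^sup>2))"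
    by (simp only: complex_norm_square)
  also have "\<dots> = complex_of_real (\<Sum>i. (cmod (coord x i))\<^sup>2)"
    by (rule suminf_of_real[symmetric]) (rule summable_coord)
  finally show ?thesis by (simp add: inner_ell2_def)
qed

instance
proof
  fix x y z :: ell2 and r s :: real
  show "x + y + z = x + (y + z)" by transfer (simp add: add.assoc)
  show "x + y = y + x" by transfer (simp add: add.commute)
  show "0 + x = x" by transfer simp
  show "- x + x = 0" by transfer simp
  show "x - y = x + - y" by (rule minus_ell2_def)
  show "r *\<^sub>R (x + y) = r *\<^sub>R x + r *\<^sub>R y" by transfer (simp add: algebra_simps)
  show "(r + s) *\<^sub>R x = r *\<^sub>R x + s *\<^sub>R x" by transfer (simp add: algebra_simps)
  show "r *\<^sub>R s *\<^sub>R x = (r * s) *\<^sub>R x" by transfer (simp add: algebra_simps)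
  show "1 *\<^sub>R x = x" by transfer simp
  show "dist x y = norm (x - y)" by (rule dist_ell2_def)
  show "uniformity = (INF e\<in>{0<..}. principal {(x :: ell2, y). dist x y < e})"
    by (rule uniformity_ell2_def)
  show "sgn x = inverse (norm x) *\<^sub>R x" by (rule sgn_ell2_def)
  show "inner x y = inner y x"
  proof -
    have "(\<Sum>i. coord x i * cnj (coord y i)) = cnj (\<Sum>i. coord y i * cnj (coord x i))"
      using sums_cnj[THEN iffD2, OF summable_sums[OF summable_coord_prod[of y x]]]
      by (simp add: mult.commute sums_iff)
    then show ?thesis by (simp add: inner_ell2_def)
  qed
  show "inner (x + y) z = inner x z + inner y z"
  proof -
    have "(\<Sum>i. coord (x + y) i * cnj (coord z i))
        = (\<Sum>i. coord x i * cnj (coord z i) + coord y i * cnj (coord z i))"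
      by (simp add: plus_ell2.rep_eq distrib_right)
    also have "\<dots> = (\<Sum>i. coord x i * cnj (coord z i)) + (\<Sum>i. coord y i * cnj (coord z i))"
      by (rule suminf_add[symmetric]; rule summable_coord_prod)
    finally show ?thesis by (simp only: inner_ell2_def plus_complex.sel)
  qed
  show "inner (r *\<^sub>R x) y = r * inner x y"
    using suminf_mult[OF summable_coord_prod[of x y], of "complex_of_real r"]
    by (simp add: inner_ell2_def scaleR_ell2.rep_eq mult.assoc)
  show "0 \<le> inner x x"
    by (simp add: inner_ell2_self suminf_nonneg summable_coord)
  show "inner x x = 0 \<longleftrightarrow> x = 0"
  proof -
    have "inner x x = 0 \<longleftrightarrow> (\<forall>i. (cmod (coord x i))\<^sup>2 = 0)"
      unfolding inner_ell2_self by (rule suminf_eq_zero_iff[OF summable_coord]) simp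
    also have "\<dots> \<longleftrightarrow> x = 0"
      by transfer auto
    finally show ?thesis .
  qed
  show "norm x = sqrt (inner x x)" by (simp add: norm_ell2_def inner_ell2_self)
next
  fix U :: "ell2 set"
  show "open U \<longleftrightarrow> (\<forall>x\<in>U. eventually (\<lambda>(x', y). x' = x \<longrightarrow> y \<in> U) uniformity)"
    by (rule open_ell2_def)
qed

end

instantiation ell2 :: complex_vector
begin

lift_definition scaleC_ell2 :: "complex \<Rightarrow> ell2 \<Rightarrow> ell2" is "\<lambda>c x i. c * x i"
  by (rule summable_sq_scale)

instance
  by standard (transfer; simp add: algebra_simps)+

end

definition cinner :: "ell2 \<Rightarrow> ell2 \<Rightarrow> complex" where
  "cinner x y = (\<Sum>i. coord x i * cnj (coord y i))"

lift_definition basis_vec :: "nat \<Rightarrow> ell2" is "\<lambda>n i. if i = n then 1 else 0"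
  by (rule summable_finite[of "{_}"]) auto

lemma cinner_basis_vec: "cinner x (basis_vec n) = coord x n"
proof -
  have "(\<Sum>i. coord x i * cnj (coord (basis_vec n) i)) = (\<Sum>i\<in>{n}. coord x i * cnj (coord (basis_vec n) i))"
    by (rule suminf_finite) (auto simp: basis_vec.rep_eq)
  then show ?thesis by (simp add: cinner_def basis_vec.rep_eq)
qed

lemma norm_ell2_sq: "(norm x)\<^sup>2 = (\<Sum>i. (cmod (coord x i))\<^sup>2)" for x :: ell2
  by (simp add: norm_ell2_def suminf_nonneg summable_coord)

lemma cinner_self: "cinner x x = complex_of_real ((norm x)\<^sup>2)"
  using suminf_of_real[OF summable_coord[of x], where 'a = complex]
  by (simp only: cinner_def norm_ell2_sq complex_norm_square)

section \<open>Bounded operators\<close>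

typedef bop = "{a :: ell2 \<Rightarrow> ell2. clinear a \<and> bounded_linear a}"
  morphisms app Abs_bop
  by (rule exI[of _ "\<lambda>_. 0"]) (auto simp: clinear_iff intro: ell2_eqI simp: scaleC_ell2.rep_eq zero_ell2.rep_eq)

setup_lifting type_definition_bop

lemma scaleC_ell2_norm: "norm (c *\<^sub>C x) = cmod c * norm x" for x :: ell2
proof -
  have "(norm (c *\<^sub>C x))\<^sup>2 = (cmod c * norm x)\<^sup>2"
    unfolding power_mult_distrib norm_ell2_sq
    by (simp add: scaleC_ell2.rep_eq norm_mult power_mult_distrib suminf_mult summable_coord)
  then show ?thesis by simp
qed

lemma bounded_linear_scaleC: "bounded_linear (\<lambda>x :: ell2. c *\<^sub>C x)"
  by (rule bounded_linear_intro[where K = "cmod c"])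
    (simp_all add: scaleC_add_right scaleR_scaleC scaleC_scaleC scaleC_ell2_norm mult.commute)

instantiation bop :: complex_vector
begin

lift_definition zero_bop :: bop is "\<lambda>_. 0"
  by (auto simp: clinear_iff intro: ell2_eqI simp: scaleC_ell2.rep_eq zero_ell2.rep_eq)

lift_definition plus_bop :: "bop \<Rightarrow> bop \<Rightarrow> bop" is "\<lambda>a b x. a x + b x"
  by (auto simp: clinear_iff scaleC_add_right intro: bounded_linear_add)

lift_definition scaleC_bop :: "complex \<Rightarrow> bop \<Rightarrow> bop" is "\<lambda>c a x. c *\<^sub>C a x"
  by (auto simp: clinear_iff scaleC_add_right scaleC_scaleC mult.commute
      intro: bounded_linear_compose[OF bounded_linear_scaleC])

definition uminus_bop :: "bop \<Rightarrow> bop" where "uminus_bop a = (-1) *\<^sub>C a"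

definition minus_bop :: "bop \<Rightarrow> bop \<Rightarrow> bop" where "minus_bop a b = a + - b"

definition scaleR_bop :: "real \<Rightarrow> bop \<Rightarrow> bop" where "scaleR_bop r a = complex_of_real r *\<^sub>C a"

instance
proof
  fix a b c :: bop and r s :: real and \<mu> \<nu> :: complex
  show "a + b + c = a + (b + c)" by transfer (simp add: add.assoc)
  show "a + b = b + a" by transfer (simp add: add.commute)
  show "0 + a = a" by transfer simp
  show "- a + a = 0" unfolding uminus_bop_def
    by transfer (auto intro!: ext ell2_eqI simp: plus_ell2.rep_eq scaleC_ell2.rep_eq zero_ell2.rep_eq)
  show "a - b = a + - b" by (rule minus_bop_def)
  show *: "\<mu> *\<^sub>C (a + b) = \<mu> *\<^sub>C a + \<mu> *\<^sub>C b" for \<mu> and a b :: bop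
    by transfer (simp add: scaleC_add_right)
  show **: "(\<mu> + \<nu>) *\<^sub>C a = \<mu> *\<^sub>C a + \<nu> *\<^sub>C a" for \<mu> \<nu> and a :: bop
    by transfer (simp add: scaleC_add_left)
  show ***: "\<mu> *\<^sub>C \<nu> *\<^sub>C a = (\<mu> * \<nu>) *\<^sub>C a" for \<mu> \<nu> and a :: bop
    by transfer (simp add: scaleC_scaleC)
  show ****: "1 *\<^sub>C a = a" for a :: bop by transfer (simp add: scaleC_one)
  show "r *\<^sub>R a = complex_of_real r *\<^sub>C a" by (rule scaleR_bop_def)
  show "r *\<^sub>R (a + b) = r *\<^sub>R a + r *\<^sub>R b" by (simp add: scaleR_bop_def *)
  show "(r + s) *\<^sub>R a = r *\<^sub>R a + s *\<^sub>R a" by (simp add: scaleR_bop_def **)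
  show "r *\<^sub>R s *\<^sub>R a = (r * s) *\<^sub>R a" by (simp add: scaleR_bop_def ***)
  show "1 *\<^sub>R a = a" by (simp add: scaleR_bop_def ****)
qed

end

lift_definition bop_comp :: "bop \<Rightarrow> bop \<Rightarrow> bop"  (infixl "\<cdot>" 70) is "\<lambda>a b x. a (b x)"
  by (auto simp: clinear_iff intro: bounded_linear_compose)

section \<open>Matrix entries and Schur products\<close>

definition entry :: "bop \<Rightarrow> nat \<Rightarrow> nat \<Rightarrow> complex" where
  "entry a i j = cinner (app a (basis_vec j)) (basis_vec i)"

text \<open>That such an operator exists and is unique is \<open>entry_schur\<close> and \<open>bop_eqI\<close> below.\<close>

definition schur :: "bop \<Rightarrow> bop \<Rightarrow> bop"  (infixl "\<star>" 70) where
  "a \<star> b = (THE c. \<forall>i j. entry c i j = entry a i j * entry b i j)"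

lemma entry_coord: "entry a i j = coord (app a (basis_vec j)) i"
  by (simp add: entry_def cinner_basis_vec)

lemma app_clinear: "clinear (app a)" and app_bounded_linear: "bounded_linear (app a)"
  using app[of a] by auto

lemma app_scaleC: "app a (c *\<^sub>C x) = c *\<^sub>C app a x"
  using app_clinear unfolding clinear_iff by blast

lemma coord_diff: "coord (x - y) i = coord x i - coord y i"
  unfolding minus_ell2_def plus_ell2.rep_eq uminus_ell2.rep_eq by simp

lemma coord_sum: "coord (\<Sum>k\<in>A. f k) i = (\<Sum>k\<in>A. coord (f k) i)"
  by (rule linear_sum[of "\<lambda>x. coord x i", unfolded o_def])
    (auto intro!: linearI simp: plus_ell2.rep_eq scaleR_ell2.rep_eq scaleR_conv_of_real)

lemma coord_le_norm: "cmod (coord x i) \<le> norm x"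
proof -
  have "(\<Sum>i\<in>{i}. (cmod (coord x i))\<^sup>2) \<le> (norm x)\<^sup>2"
    unfolding norm_ell2_sq by (rule sum_le_suminf[OF summable_coord]) auto
  then show ?thesis by (simp add: power2_le_iff_abs_le)
qed

lemma bounded_linear_coord: "bounded_linear (\<lambda>x. coord x i)"
  by (rule bounded_linear_intro[where K = 1])
    (simp_all add: plus_ell2.rep_eq scaleR_ell2.rep_eq coord_le_norm scaleR_conv_of_real)

lemma coord_truncate:
  "coord (\<Sum>j<n. f j *\<^sub>C basis_vec j) i = (if i < n then f i else 0)"
proof -
  have "coord (\<Sum>j<n. f j *\<^sub>C basis_vec j) i = (\<Sum>j<n. if i = j then f j else 0)"
    by (simp add: coord_sum scaleC_ell2.rep_eq basis_vec.rep_eq if_distrib cong: if_cong)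
  then show ?thesis by simp
qed

lemma norm_truncate: "(norm (\<Sum>j<n. f j *\<^sub>C basis_vec j))\<^sup>2 = (\<Sum>j<n. (cmod (f j))\<^sup>2)"
proof -
  have "(norm (\<Sum>j<n. f j *\<^sub>C basis_vec j))\<^sup>2 = (\<Sum>i. if i < n then (cmod (f i))\<^sup>2 else 0)"
    unfolding norm_ell2_sq by (rule suminf_cong) (simp add: coord_truncate)
  also have "\<dots> = (\<Sum>i<n. if i < n then (cmod (f i))\<^sup>2 else 0)"
    by (rule suminf_finite) auto
  finally show ?thesis by simp
qed

lemma ell2_expansion: "(\<lambda>j. coord x j *\<^sub>C basis_vec j) sums x"
  unfolding sums_def tendsto_iff
proof (intro allI impI)
  fix e :: real assume e: "e > 0"
  let ?s = "\<lambda>n. \<Sum>j<n. coord x j *\<^sub>C basis_vec j"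
  have dist: "(dist (?s n) x)\<^sup>2 = (\<Sum>i. (cmod (coord x (i + n)))\<^sup>2)" for n
  proof -
    have "coord (x - ?s n) i = (if i < n then 0 else coord x i)" for i
      by (simp add: coord_diff coord_truncate)
    then have c: "(cmod (coord (x - ?s n) i))\<^sup>2 = (if i < n then 0 else (cmod (coord x i))\<^sup>2)" for i
      by simp
    have "(dist (?s n) x)\<^sup>2 = (\<Sum>i. (cmod (coord (x - ?s n) i))\<^sup>2)"
      by (simp only: dist_norm norm_minus_commute[of "?s n" x] norm_ell2_sq)
    also have "\<dots> = (\<Sum>i. (cmod (coord (x - ?s n) (i + n)))\<^sup>2)
        + (\<Sum>i<n. (cmod (coord (x - ?s n) i))\<^sup>2)"
      by (rule suminf_split_initial_segment[OF summable_coord])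
    finally show ?thesis by (simp add: c)
  qed
  from suminf_exist_split[of "e\<^sup>2" "\<lambda>i. (cmod (coord x i))\<^sup>2"] e summable_coord[of x]
  obtain N where N: "\<And>n. n \<ge> N \<Longrightarrow> norm (\<Sum>i. (cmod (coord x (i + n)))\<^sup>2) < e\<^sup>2" by auto
  have "dist (?s n) x < e" if "n \<ge> N" for n
  proof (rule power_less_imp_less_base)
    show "(dist (?s n) x)\<^sup>2 < e\<^sup>2" using N[OF that] unfolding dist[symmetric] by simp
  qed (use e in simp)
  then show "\<forall>\<^sub>F n in sequentially. dist (?s n) x < e"
    unfolding eventually_sequentially by blast
qed

lemma app_sums: "(\<lambda>j. entry a i j * coord x j) sums coord (app a x) i"
proof -
  have "(\<lambda>j. coord (app a (coord x j *\<^sub>C basis_vec j)) i) sums coord (app a x) i"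
    using bounded_linear.sums[OF bounded_linear_coord
        bounded_linear.sums[OF app_bounded_linear ell2_expansion]] .
  moreover have "coord (app a (coord x j *\<^sub>C basis_vec j)) i = entry a i j * coord x j" for j
    by (simp add: app_scaleC scaleC_ell2.rep_eq entry_coord)
  ultimately show ?thesis by simp
qed

lemma bop_eqI:
  assumes "\<And>i j. entry a i j = entry b i j"
  shows "a = b"
proof -
  have "coord (app a x) i = coord (app b x) i" for x i
    using app_sums[of a i x] app_sums[of b i x] unfolding assms by (rule sums_unique2)
  then show ?thesis
    using app_inject ell2_eqI by blast
qed

lemma column_bound:
  assumes "\<And>x. norm (app a x) \<le> K * norm x"
  shows "(\<Sum>i<n. (cmod (entry a i j))\<^sup>2) \<le> K\<^sup>2"
proof -
  have "norm (basis_vec j) = 1"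
  proof -
    have "cinner (basis_vec j) (basis_vec j) = 1"
      by (simp add: cinner_basis_vec basis_vec.rep_eq)
    then have "(norm (basis_vec j))\<^sup>2 = 1"
      unfolding cinner_self using of_real_eq_1_iff by blast
    then show ?thesis
      using norm_ge_zero[of "basis_vec j"] by (simp add: power2_eq_1_iff del: norm_ge_zero)
  qed
  then have le: "norm (app a (basis_vec j)) \<le> K" using assms[of "basis_vec j"] by simp
  have "(\<Sum>i<n. (cmod (entry a i j))\<^sup>2) \<le> (norm (app a (basis_vec j)))\<^sup>2"
    unfolding norm_ell2_sq entry_coord by (rule sum_le_suminf[OF summable_coord]) auto
  also have "\<dots> \<le> K\<^sup>2" using le by (intro power_mono) auto
  finally show ?thesis .
qed

lemma row_bound:
  assumes "\<And>x. norm (app a x) \<le> K * norm x"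
  shows "(\<Sum>j<n. (cmod (entry a i j))\<^sup>2) \<le> K\<^sup>2"
proof -
  define S where "S = (\<Sum>j<n. (cmod (entry a i j))\<^sup>2)"
  define x where "x = (\<Sum>j<n. cnj (entry a i j) *\<^sub>C basis_vec j)"
  have S0: "S \<ge> 0" by (simp add: S_def sum_nonneg)
  have "coord (app a x) i = (\<Sum>j. entry a i j * coord x j)"
    using app_sums sums_unique by blast
  also have "\<dots> = (\<Sum>j<n. entry a i j * coord x j)"
    by (rule suminf_finite) (auto simp: x_def coord_truncate)
  also have "\<dots> = complex_of_real S"
    by (simp add: S_def x_def coord_truncate complex_norm_square del: of_real_power)
  finally have "S = cmod (coord (app a x) i)" using S0 by simp
  also have "\<dots> \<le> K * norm x" using coord_le_norm assms order_trans by blast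
  finally have "S\<^sup>2 \<le> (K * norm x)\<^sup>2" using S0 by (intro power_mono)
  also have "\<dots> = K\<^sup>2 * S"
    by (simp add: power_mult_distrib x_def norm_truncate S_def)
  finally have "S * S \<le> K\<^sup>2 * S" by (simp add: power2_eq_square)
  then have "S \<le> K\<^sup>2" using S0 by (cases "S = 0") auto
  then show ?thesis by (simp add: S_def)
qed

lemma Cauchy_Schwarz_series:
  fixes z w :: "nat \<Rightarrow> complex"
  assumes z: "summable (\<lambda>i. (cmod (z i))\<^sup>2)" and w: "summable (\<lambda>i. (cmod (w i))\<^sup>2)"
  shows "summable (\<lambda>i. z i * w i)"
    and "(cmod (\<Sum>i. z i * w i))\<^sup>2 \<le> (\<Sum>i. (cmod (z i))\<^sup>2) * (\<Sum>i. (cmod (w i))\<^sup>2)"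
proof -
  have s: "summable (\<lambda>i. norm (z i * w i))"
    using summable_sq_prod[OF z w] by (simp add: norm_mult)
  then show s': "summable (\<lambda>i. z i * w i)" by (rule summable_norm_cancel)
  have "(cmod (\<Sum>i<n. z i * w i))\<^sup>2 \<le> (\<Sum>i. (cmod (z i))\<^sup>2) * (\<Sum>i. (cmod (w i))\<^sup>2)" for n
  proof -
    have "(cmod (\<Sum>i<n. z i * w i))\<^sup>2 \<le> (\<Sum>i<n. cmod (z i) * cmod (w i))\<^sup>2"
      by (intro power_mono sum_norm_le) (simp_all add: norm_mult)
    also have "\<dots> \<le> (\<Sum>i<n. (cmod (z i))\<^sup>2) * (\<Sum>i<n. (cmod (w i))\<^sup>2)"
      by (rule Cauchy_Schwarz_ineq_sum)
    also have "\<dots> \<le> (\<Sum>i. (cmod (z i))\<^sup>2) * (\<Sum>i. (cmod (w i))\<^sup>2)"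
      by (intro mult_mono sum_le_suminf z w suminf_nonneg sum_nonneg) auto
    finally show ?thesis .
  qed
  moreover have "(\<lambda>n. (cmod (\<Sum>i<n. z i * w i))\<^sup>2) \<longlonglongrightarrow> (cmod (\<Sum>i. z i * w i))\<^sup>2"
    by (intro tendsto_intros summable_LIMSEQ s')
  ultimately show "(cmod (\<Sum>i. z i * w i))\<^sup>2 \<le> (\<Sum>i. (cmod (z i))\<^sup>2) * (\<Sum>i. (cmod (w i))\<^sup>2)"
    by (intro LIMSEQ_le_const2) auto
qed

lemma schur_exists: "\<exists>c. \<forall>i j. entry c i j = entry a i j * entry b i j"
proof -
  obtain K where K: "\<And>x. norm (app a x) \<le> K * norm x"
    using bounded_linear.bounded[OF app_bounded_linear[of a]] by (auto simp: mult.commute)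
  obtain L where L: "\<And>x. norm (app b x) \<le> L * norm x"
    using bounded_linear.bounded[OF app_bounded_linear[of b]] by (auto simp: mult.commute)
  have row: "summable (\<lambda>j. (cmod (entry a i j))\<^sup>2)" "(\<Sum>j. (cmod (entry a i j))\<^sup>2) \<le> K\<^sup>2" for i
  proof -
    show *: "summable (\<lambda>j. (cmod (entry a i j))\<^sup>2)"
      by (rule summableI_nonneg_bounded[where x = "K\<^sup>2"]) (use row_bound[OF K] in auto)
    show "(\<Sum>j. (cmod (entry a i j))\<^sup>2) \<le> K\<^sup>2"
      using row_bound[OF K] by (intro suminf_le_const *)
  qed
  have b_le: "(cmod (entry b i j))\<^sup>2 \<le> L\<^sup>2" for i j
  proof -
    have "(\<Sum>i\<in>{i}. (cmod (entry b i j))\<^sup>2) \<le> (\<Sum>i<Suc i. (cmod (entry b i j))\<^sup>2)"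
      by (rule sum_mono2) auto
    then show ?thesis using column_bound[OF L, where n = "Suc i" and j = j] by (simp del: sum.lessThan_Suc)
  qed
  have w: "summable (\<lambda>j. (cmod (entry b i j * coord x j))\<^sup>2)" for i x
  proof (rule summable_comparison_test)
    show "summable (\<lambda>j. L\<^sup>2 * (cmod (coord x j))\<^sup>2)"
      by (intro summable_mult summable_coord)
    show "\<exists>N. \<forall>n\<ge>N. norm ((cmod (entry b i n * coord x n))\<^sup>2) \<le> L\<^sup>2 * (cmod (coord x n))\<^sup>2"
      using b_le by (simp add: norm_mult power_mult_distrib mult_right_mono)
  qed
  define f where "f x i = (\<Sum>j. entry a i j * (entry b i j * coord x j))" for x i
  have sf: "summable (\<lambda>j. entry a i j * (entry b i j * coord x j))" for x i
    by (rule Cauchy_Schwarz_series(1)[OF row(1) w])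
  have f_le: "(\<Sum>i<n. (cmod (f x i))\<^sup>2) \<le> (K * L * norm x)\<^sup>2" for n x
  proof -
    have "(\<Sum>i<n. (cmod (f x i))\<^sup>2) \<le> (\<Sum>i<n. K\<^sup>2 * (\<Sum>j. (cmod (entry b i j * coord x j))\<^sup>2))"
    proof (rule sum_mono)
      fix i
      have "(cmod (f x i))\<^sup>2
          \<le> (\<Sum>j. (cmod (entry a i j))\<^sup>2) * (\<Sum>j. (cmod (entry b i j * coord x j))\<^sup>2)"
        unfolding f_def by (rule Cauchy_Schwarz_series(2)[OF row(1) w])
      also have "\<dots> \<le> K\<^sup>2 * (\<Sum>j. (cmod (entry b i j * coord x j))\<^sup>2)"
        by (intro mult_right_mono row(2) suminf_nonneg w) simp
      finally show "(cmod (f x i))\<^sup>2 \<le> K\<^sup>2 * (\<Sum>j. (cmod (entry b i j * coord x j))\<^sup>2)" .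
    qed
    also have "\<dots> = K\<^sup>2 * (\<Sum>j. \<Sum>i<n. (cmod (entry b i j * coord x j))\<^sup>2)"
      by (simp only: sum_distrib_left suminf_sum[OF w])
    also have "\<dots> \<le> K\<^sup>2 * (\<Sum>j. L\<^sup>2 * (cmod (coord x j))\<^sup>2)"
    proof (intro mult_left_mono suminf_le)
      fix j
      have "(\<Sum>i<n. (cmod (entry b i j * coord x j))\<^sup>2)
          = (\<Sum>i<n. (cmod (entry b i j))\<^sup>2) * (cmod (coord x j))\<^sup>2"
        by (simp add: norm_mult power_mult_distrib sum_distrib_right)
      also have "\<dots> \<le> L\<^sup>2 * (cmod (coord x j))\<^sup>2"
        by (intro mult_right_mono column_bound[OF L]) simp
      finally show "(\<Sum>i<n. (cmod (entry b i j * coord x j))\<^sup>2) \<le> L\<^sup>2 * (cmod (coord x j))\<^sup>2" .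
    next
      show "summable (\<lambda>j. \<Sum>i<n. (cmod (entry b i j * coord x j))\<^sup>2)"
        by (intro summable_sum w)
      show "summable (\<lambda>j. L\<^sup>2 * (cmod (coord x j))\<^sup>2)"
        by (intro summable_mult summable_coord)
    qed simp
    also have "\<dots> = (K * L * norm x)\<^sup>2"
      by (simp add: suminf_mult summable_coord norm_ell2_sq power_mult_distrib)
    finally show ?thesis .
  qed
  have f_sq: "summable (\<lambda>i. (cmod (f x i))\<^sup>2)" for x
    by (rule summableI_nonneg_bounded[where x = "(K * L * norm x)\<^sup>2"]) (use f_le in auto)
  define g where "g x = Abs_ell2 (f x)" for x
  have g: "coord (g x) i = f x i" for x i
    by (simp add: g_def Abs_ell2_inverse f_sq)
  have f_add: "f (x + y) i = f x i + f y i" for x y i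
    using suminf_add[OF sf sf] by (simp add: f_def plus_ell2.rep_eq distrib_left)
  have f_scale: "f (c *\<^sub>C x) i = c * f x i" for c x i
    using suminf_mult[OF sf, of c i x]
    by (simp add: f_def scaleC_ell2.rep_eq mult_ac)
  have g_lin: "clinear g"
    by (auto simp: clinear_iff g f_add f_scale plus_ell2.rep_eq scaleC_ell2.rep_eq intro!: ell2_eqI)
  have "norm (g x) \<le> norm x * \<bar>K * L\<bar>" for x
  proof -
    have "(norm (g x))\<^sup>2 \<le> (K * L * norm x)\<^sup>2"
      unfolding norm_ell2_sq g by (intro suminf_le_const f_sq f_le)
    then have "\<bar>norm (g x)\<bar> \<le> \<bar>K * L * norm x\<bar>" by (rule abs_le_square_iff[THEN iffD2])
    then show ?thesis by (simp add: abs_mult mult_ac)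
  qed
  then have "bounded_linear g"
    using g_lin by (intro bounded_linear_intro) (auto simp: clinear_iff scaleR_scaleC)
  with g_lin have app_g: "app (Abs_bop g) = g" by (simp add: Abs_bop_inverse)
  have "entry (Abs_bop g) i j = entry a i j * entry b i j" for i j
  proof -
    have "entry (Abs_bop g) i j = (\<Sum>k. entry a i k * (entry b i k * coord (basis_vec j) k))"
      by (simp add: entry_coord app_g g f_def)
    also have "\<dots> = (\<Sum>k\<in>{j}. entry a i k * (entry b i k * coord (basis_vec j) k))"
      by (rule suminf_finite) (auto simp: basis_vec.rep_eq)
    finally show ?thesis by (simp add: basis_vec.rep_eq)
  qed
  then show ?thesis by blast
qed

lemma entry_schur: "entry (a \<star> b) i j = entry a i j * entry b i j"
proof -
  have "\<exists>!c. \<forall>i j. entry c i j = entry a i j * entry b i j"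
    using schur_exists by (auto intro: bop_eqI)
  from theI'[OF this] show ?thesis by (simp add: schur_def)
qed

definition schur_multiplicative :: "(bop \<Rightarrow> bop) \<Rightarrow> bool" where
  "schur_multiplicative T \<longleftrightarrow> (\<forall>a b. T a \<star> T b = T (a \<star> b))"

section \<open>The operator space structure\<close>

text \<open>A \<open>k \<times> k\<close> matrix over \<^typ>\<open>bop\<close> is a function \<open>x\<close> of which only the values \<open>x r s\<close> with
  \<open>r, s < k\<close> are used; likewise for vectors of the \<open>k\<close>-fold direct sum, whose norm is
  \<^const>\<open>L2_set\<close> of the norms of the components.\<close>

definition mat_app :: "nat \<Rightarrow> (nat \<Rightarrow> nat \<Rightarrow> bop) \<Rightarrow> (nat \<Rightarrow> ell2) \<Rightarrow> nat \<Rightarrow> ell2" where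
  "mat_app k x \<xi> r = (\<Sum>s<k. app (x r s) (\<xi> s))"

definition dsum_norm :: "nat \<Rightarrow> (nat \<Rightarrow> ell2) \<Rightarrow> real" where
  "dsum_norm k \<xi> = L2_set (\<lambda>s. norm (\<xi> s)) {..<k}"

definition mat_norm :: "nat \<Rightarrow> (nat \<Rightarrow> nat \<Rightarrow> bop) \<Rightarrow> real" where
  "mat_norm k x = (SUP \<xi> \<in> {\<xi>. dsum_norm k \<xi> \<le> 1}. dsum_norm k (mat_app k x \<xi>))"

text \<open>The supremum is taken over a nonempty bounded set, so it has its usual meaning.\<close>

lemma mat_norm_welldefined:
  "{\<xi>. dsum_norm k \<xi> \<le> 1} \<noteq> {}"
  "bdd_above ((\<lambda>\<xi>. dsum_norm k (mat_app k x \<xi>)) ` {\<xi>. dsum_norm k \<xi> \<le> 1})"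
proof -
  have "dsum_norm k (\<lambda>_. 0) \<le> 1" by (simp add: dsum_norm_def L2_set_def)
  then show "{\<xi>. dsum_norm k \<xi> \<le> 1} \<noteq> {}" by blast
  have comp: "norm (app a y) \<le> onorm (app a)" if "norm y \<le> 1" for a y
  proof -
    have "norm (app a y) \<le> onorm (app a) * norm y"
      by (rule onorm[OF app_bounded_linear])
    also have "\<dots> \<le> onorm (app a) * 1"
      by (intro mult_left_mono that onorm_pos_le[OF app_bounded_linear])
    finally show ?thesis by simp
  qed
  show "bdd_above ((\<lambda>\<xi>. dsum_norm k (mat_app k x \<xi>)) ` {\<xi>. dsum_norm k \<xi> \<le> 1})"
  proof (rule bdd_aboveI2)
    fix \<xi> assume "\<xi> \<in> {\<xi>. dsum_norm k \<xi> \<le> 1}"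
    then have \<xi>: "dsum_norm k \<xi> \<le> 1" by simp
    have 1: "norm (\<xi> s) \<le> 1" if "s < k" for s
      using member_le_L2_set[of "{..<k}" s "\<lambda>s. norm (\<xi> s)"] that \<xi> by (simp add: dsum_norm_def)
    have "dsum_norm k (mat_app k x \<xi>) \<le> (\<Sum>r<k. norm (mat_app k x \<xi> r))"
      unfolding dsum_norm_def by (rule L2_set_le_sum) simp
    also have "\<dots> \<le> (\<Sum>r<k. \<Sum>s<k. onorm (app (x r s)))"
      unfolding mat_app_def by (intro sum_mono sum_norm_le comp 1) simp
    finally show "dsum_norm k (mat_app k x \<xi>) \<le> (\<Sum>r<k. \<Sum>s<k. onorm (app (x r s)))" .
  qed
qed

definition amplification ::
    "(bop \<Rightarrow> bop) \<Rightarrow> (nat \<Rightarrow> nat \<Rightarrow> bop) \<Rightarrow> (nat \<Rightarrow> nat \<Rightarrow> bop)" where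
  "amplification T x = (\<lambda>r s. T (x r s))"

definition completely_contractive :: "(bop \<Rightarrow> bop) \<Rightarrow> bool" where
  "completely_contractive T \<longleftrightarrow>
    (\<forall>k\<ge>1. \<forall>x. mat_norm k (amplification T x) \<le> mat_norm k x)"

definition complete_isometry :: "(bop \<Rightarrow> bop) \<Rightarrow> bool" where
  "complete_isometry T \<longleftrightarrow>
    (\<forall>k\<ge>1. \<forall>x. mat_norm k (amplification T x) = mat_norm k x)"

section \<open>Permutation unitaries\<close>

definition unitary :: "bop \<Rightarrow> bool" where
  "unitary u \<longleftrightarrow> surj (app u) \<and> (\<forall>x y. cinner (app u x) (app u y) = cinner x y)"

definition permutation_unitary :: "bop \<Rightarrow> bool" where
  "permutation_unitary u \<longleftrightarrow>
    unitary u \<and> (\<exists>\<pi>. bij \<pi> \<and> (\<forall>i. app u (basis_vec i) = basis_vec (\<pi> i)))"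

end

theory Submission
  imports Defs
begin

text \<open>
  The matrix units are exactly the minimal nonzero idempotents of \<open>B(\<ell>\<^sup>2)\<close> under the Schur product.
  A Schur multiplicative linear bijection \<open>T\<close> is an automorphism of that algebra, so it permutes
  them, say \<open>T E\<^sub>x = E\<^bsub>\<sigma> x\<^esub>\<close> for a permutation \<open>\<sigma>\<close> of \<open>\<nat> \<times> \<nat>\<close> (\<open>schur_automorphism_permutes_units\<close>).
  Since \<open>a \<star> E\<^sub>x = a\<^sub>x E\<^sub>x\<close>, the matrix of \<open>T a\<close> is then the matrix of \<open>a\<close> with its entries moved
  by \<open>\<sigma>\<close>.

  What remains is to see that \<open>\<sigma>\<close> moves rows to rows and columns to columns. Here complete
  contractivity enters, and \<open>2 \<times> 2\<close> amplifications suffice. The operator \<open>[E\<^sub>i\<^sub>j E\<^sub>k\<^sub>l]\<close> has norm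
  \<open>1\<close> if \<open>i \<noteq> k\<close> and \<open>\<surd>2\<close> if \<open>i = k\<close>, so \<open>\<sigma>\<close> takes entries in different rows to entries in different
  rows; the transposed arrangement, a column with the entries \<open>E\<^sub>i\<^sub>j\<close> and \<open>E\<^sub>k\<^sub>l\<close>, says the same for
  columns. Read backwards, the row of \<open>\<sigma>\<^sup>-\<^sup>1 (r, c)\<close> depends only on \<open>r\<close> and its column only on \<open>c\<close>, so
  \<open>\<sigma>\<^sup>-\<^sup>1 = \<rho> \<times> \<kappa>\<close>, and a product map is bijective only if both factors are. The operators that
  permute the basis by \<open>\<rho>\<^sup>-\<^sup>1\<close> and by \<open>\<kappa>\<close> are the required \<open>u\<close> and \<open>v\<close>.

  Conversely, multiplication by unitaries on both sides is a complete isometry, and multiplication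
  by permutation unitaries only rearranges the matrix entries, so it respects the Schur product.
\<close>

section \<open>Entries and matrix units\<close>

lemma entry_scaleC: "entry (c *\<^sub>C a) i j = c * entry a i j"
  by (simp add: entry_coord scaleC_bop.rep_eq scaleC_ell2.rep_eq)

lemma entry_zero: "entry 0 i j = 0"
  by (simp add: entry_coord zero_bop.rep_eq zero_ell2.rep_eq)

lemma norm_basis_vec: "norm (basis_vec i) = 1"
proof -
  have "complex_of_real ((norm (basis_vec i))\<^sup>2) = 1"
    unfolding cinner_self[symmetric] by (simp add: cinner_basis_vec basis_vec.rep_eq)
  then have "(norm (basis_vec i))\<^sup>2 = 1"
    using of_real_eq_1_iff by blast
  then show ?thesis
    using norm_ge_zero[of "basis_vec i"] by (simp add: power2_eq_1_iff del: norm_ge_zero)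
qed

lift_definition matrix_unit :: "nat \<Rightarrow> nat \<Rightarrow> bop" is "\<lambda>i j x. coord x j *\<^sub>C basis_vec i"
proof -
  fix i j
  have lin: "clinear (\<lambda>x. coord x j *\<^sub>C basis_vec i)"
    by (simp add: clinear_iff plus_ell2.rep_eq scaleC_ell2.rep_eq scaleC_add_left scaleC_scaleC)
  have "bounded_linear (\<lambda>x. coord x j *\<^sub>C basis_vec i)"
    by (rule bounded_linear_intro[where K = 1])
      (use lin in \<open>simp_all add: clinear_iff scaleR_scaleC scaleC_ell2_norm norm_basis_vec
        coord_le_norm\<close>)
  with lin show "clinear (\<lambda>x. coord x j *\<^sub>C basis_vec i)
      \<and> bounded_linear (\<lambda>x. coord x j *\<^sub>C basis_vec i)" ..
qed

lemma entry_matrix_unit: "entry (matrix_unit i j) k l = (if (i, j) = (k, l) then 1 else 0)"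
  by (auto simp: entry_coord matrix_unit.rep_eq scaleC_ell2.rep_eq basis_vec.rep_eq)

lemma schur_matrix_unit: "a \<star> matrix_unit i j = entry a i j *\<^sub>C matrix_unit i j"
  by (rule bop_eqI) (simp add: entry_schur entry_scaleC entry_matrix_unit)

lemma schur_commute: "a \<star> b = b \<star> a"
  by (rule bop_eqI) (simp add: entry_schur)

section \<open>Schur multiplicative linear bijections\<close>

text \<open>The preimage \<open>c\<close> of a matrix unit below the idempotent \<open>T E\<^sub>i\<^sub>j\<close> shows that this idempotent
  is minimal: \<open>c \<star> E\<^sub>i\<^sub>j\<close> is a multiple of \<open>E\<^sub>i\<^sub>j\<close>, so its image is a multiple of \<open>T E\<^sub>i\<^sub>j\<close>.\<close>

lemma image_matrix_unit:
  assumes "clinear T" "bij T" "schur_multiplicative T"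
  shows "\<exists>r c. T (matrix_unit i j) = matrix_unit r c"
proof -
  have scale: "T (z *\<^sub>C a) = z *\<^sub>C T a" for z a
    using assms(1) by (simp add: clinear_iff)
  have mult: "T (a \<star> b) = T a \<star> T b" for a b
    using assms(3) by (simp add: schur_multiplicative_def)
  let ?p = "T (matrix_unit i j)"
  \<comment> \<open>A vector is nonzero if it differs from its double; in this form injectivity and homogeneity
      of \<open>T\<close> transport the property at once.\<close>
  have "matrix_unit i j \<noteq> 2 *\<^sub>C matrix_unit i j"
  proof
    assume "matrix_unit i j = 2 *\<^sub>C matrix_unit i j"
    then have "entry (matrix_unit i j) i j = entry (2 *\<^sub>C matrix_unit i j) i j" by simp
    then show False by (simp add: entry_scaleC entry_matrix_unit)
  qed
  then have "?p \<noteq> 2 *\<^sub>C ?p"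
    using assms(2) by (simp add: scale[symmetric] bij_is_inj inj_eq)
  then obtain r c where rc: "entry ?p r c \<noteq> 0"
    using bop_eqI[of ?p "2 *\<^sub>C ?p"] by (force simp: entry_scaleC)
  have "?p \<star> ?p = ?p"
    unfolding mult[symmetric] by (simp add: schur_matrix_unit entry_matrix_unit scaleC_one)
  then have "entry ?p r c * entry ?p r c = entry ?p r c"
    by (metis entry_schur)
  with rc have one: "entry ?p r c = 1" by simp
  obtain d where d: "T d = matrix_unit r c"
    using assms(2) by (metis bij_pointE)
  have "entry d i j *\<^sub>C ?p = T d \<star> ?p"
    by (simp add: scale[symmetric] mult[symmetric] schur_matrix_unit)
  also have "\<dots> = matrix_unit r c"
    using schur_matrix_unit[of ?p r c] by (simp add: d schur_commute one scaleC_one)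
  finally have eq: "entry d i j *\<^sub>C ?p = matrix_unit r c" .
  then have "entry (entry d i j *\<^sub>C ?p) r c = entry (matrix_unit r c) r c" by simp
  then have "entry d i j = 1"
    by (simp add: entry_scaleC one entry_matrix_unit)
  with eq have "?p = matrix_unit r c" by (simp add: scaleC_one)
  then show ?thesis by blast
qed

lemma matrix_unit_eq_iff: "matrix_unit i j = matrix_unit k l \<longleftrightarrow> i = k \<and> j = l"
  using entry_matrix_unit[of i j k l] entry_matrix_unit[of k l k l] by (auto split: if_splits)

text \<open>Applying \<open>T\<close> to \<open>a \<star> E\<^sub>i\<^sub>j = a\<^sub>i\<^sub>j E\<^sub>i\<^sub>j\<close> reads off an entry of \<open>T a\<close>, so that the images of
  the matrix units determine \<open>T\<close>.\<close>

lemma schur_automorphism_permutes_units: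
  assumes "clinear T" "bij T" "schur_multiplicative T"
  obtains \<sigma> where "bij \<sigma>"
    and "\<And>i j. T (matrix_unit i j) = case_prod matrix_unit (\<sigma> (i, j))"
    and "\<And>a i j. case_prod (entry (T a)) (\<sigma> (i, j)) = entry a i j"
proof -
  have scale: "T (z *\<^sub>C a) = z *\<^sub>C T a" for z a
    using assms(1) by (simp add: clinear_iff)
  have mult: "T (a \<star> b) = T a \<star> T b" for a b
    using assms(3) by (simp add: schur_multiplicative_def)
  have "\<forall>x. \<exists>y. T (case_prod matrix_unit x) = case_prod matrix_unit y"
    using image_matrix_unit[OF assms] by fastforce
  then obtain \<sigma> where \<sigma>: "\<And>x. T (case_prod matrix_unit x) = case_prod matrix_unit (\<sigma> x)"
    by metis
  have unit: "T (matrix_unit i j) = case_prod matrix_unit (\<sigma> (i, j))" for i j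
    using \<sigma>[of "(i, j)"] by simp
  have entries: "case_prod (entry (T a)) (\<sigma> (i, j)) = entry a i j" for a i j
  proof -
    obtain r c where rc: "\<sigma> (i, j) = (r, c)" by force
    have "entry (T a) r c *\<^sub>C matrix_unit r c = T a \<star> T (matrix_unit i j)"
      by (simp add: unit rc schur_matrix_unit)
    also have "\<dots> = entry a i j *\<^sub>C matrix_unit r c"
      by (simp add: mult[symmetric] schur_matrix_unit scale) (simp add: unit rc)
    finally have "entry (entry (T a) r c *\<^sub>C matrix_unit r c) r c
        = entry (entry a i j *\<^sub>C matrix_unit r c) r c" by simp
    then show ?thesis by (simp add: entry_scaleC entry_matrix_unit rc)
  qed
  have "inj \<sigma>"
  proof (rule injI)
    fix x y assume "\<sigma> x = \<sigma> y"
    then have "T (case_prod matrix_unit x) = T (case_prod matrix_unit y)" by (simp add: \<sigma>)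
    then have "case_prod matrix_unit x = case_prod matrix_unit y"
      using assms(2) by (simp add: bij_is_inj inj_eq)
    then show "x = y" by (cases x; cases y) (simp add: matrix_unit_eq_iff)
  qed
  moreover have "surj \<sigma>"
  unfolding surj_def
  proof
    show "\<exists>x. y = \<sigma> x" for y
    proof -
      obtain r c where y: "y = (r, c)" by force
      obtain d where d: "T d = matrix_unit r c" using assms(2) by (metis bij_pointE)
      \<comment> \<open>If \<open>\<sigma>\<close> missed \<open>(r, c)\<close>, then \<open>T d\<close> would vanish on the range of \<open>\<sigma>\<close>, whence \<open>d = 0\<close>.\<close>
      have "\<exists>i j. entry d i j \<noteq> 0"
      proof (rule ccontr)
        assume "\<not> (\<exists>i j. entry d i j \<noteq> 0)"
        then have "d = 2 *\<^sub>C d" by (intro bop_eqI) (simp add: entry_scaleC)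
        then have "matrix_unit r c = 2 *\<^sub>C matrix_unit r c" by (metis scale d)
        then have "entry (matrix_unit r c) r c = entry (2 *\<^sub>C matrix_unit r c) r c" by simp
        then show False by (simp add: entry_scaleC entry_matrix_unit)
      qed
      then obtain i j where "entry d i j \<noteq> 0" by blast
      then have "case_prod (entry (matrix_unit r c)) (\<sigma> (i, j)) \<noteq> 0"
        by (simp add: entries[symmetric] d)
      then have "y = \<sigma> (i, j)"
        by (auto simp: y entry_matrix_unit split: prod.splits if_splits)
      then show ?thesis ..
    qed
  qed
  ultimately have "bij \<sigma>" by (rule bijI)
  with unit entries show ?thesis using that by blast
qed

section \<open>Norms of rows and columns of matrix units\<close>

lemma dsum_norm_le_mat_norm:
  "dsum_norm k \<xi> \<le> 1 \<Longrightarrow> dsum_norm k (mat_app k x \<xi>) \<le> mat_norm k x"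
  unfolding mat_norm_def by (rule cSUP_upper[OF _ mat_norm_welldefined(2)]) simp

lemma mat_norm_leI:
  "(\<And>\<xi>. dsum_norm k \<xi> \<le> 1 \<Longrightarrow> dsum_norm k (mat_app k x \<xi>) \<le> M) \<Longrightarrow> mat_norm k x \<le> M"
  unfolding mat_norm_def by (rule cSUP_least[OF mat_norm_welldefined(1)]) simp

text \<open>A pair of operators placed side by side, or one above the other, is padded with zeros to a
  \<open>2 \<times> 2\<close> matrix, because amplifications act on square matrices.\<close>

definition row_pair :: "bop \<Rightarrow> bop \<Rightarrow> nat \<Rightarrow> nat \<Rightarrow> bop" where
  "row_pair a b = (\<lambda>r s. if r = 0 then if s = 0 then a else b else 0)"

definition col_pair :: "bop \<Rightarrow> bop \<Rightarrow> nat \<Rightarrow> nat \<Rightarrow> bop" where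
  "col_pair a b = (\<lambda>r s. if s = 0 then if r = 0 then a else b else 0)"

lemma dsum_norm_2: "dsum_norm 2 \<xi> = sqrt ((norm (\<xi> 0))\<^sup>2 + (norm (\<xi> 1))\<^sup>2)"
  by (simp add: dsum_norm_def L2_set_def numeral_2_eq_2)

lemma dsum_norm_row_pair:
  "dsum_norm 2 (mat_app 2 (row_pair a b) \<xi>) = norm (app a (\<xi> 0) + app b (\<xi> 1))"
  by (simp add: dsum_norm_2) (simp add: mat_app_def row_pair_def numeral_2_eq_2 zero_bop.rep_eq)

lemma dsum_norm_col_pair:
  "dsum_norm 2 (mat_app 2 (col_pair a b) \<xi>)
    = sqrt ((norm (app a (\<xi> 0)))\<^sup>2 + (norm (app b (\<xi> 0)))\<^sup>2)"
  by (simp add: dsum_norm_2) (simp add: mat_app_def col_pair_def numeral_2_eq_2 zero_bop.rep_eq)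

lemma norm_two_basis_vecs:
  assumes "i \<noteq> k"
  shows "norm (\<alpha> *\<^sub>C basis_vec i + \<beta> *\<^sub>C basis_vec k) = sqrt ((cmod \<alpha>)\<^sup>2 + (cmod \<beta>)\<^sup>2)"
proof -
  let ?x = "\<alpha> *\<^sub>C basis_vec i + \<beta> *\<^sub>C basis_vec k"
  have c: "coord ?x n = (if n = i then \<alpha> else if n = k then \<beta> else 0)" for n
    using assms by (simp add: plus_ell2.rep_eq scaleC_ell2.rep_eq basis_vec.rep_eq)
  have "(norm ?x)\<^sup>2 = (\<Sum>n\<in>{i, k}. (cmod (coord ?x n))\<^sup>2)"
    unfolding norm_ell2_sq by (rule suminf_finite) (auto simp: c)
  also have "\<dots> = (cmod \<alpha>)\<^sup>2 + (cmod \<beta>)\<^sup>2"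
    unfolding c using assms by simp
  finally show ?thesis by (metis norm_ge_zero real_sqrt_unique)
qed

lemma mat_norm_row_units: "mat_norm 2 (row_pair (matrix_unit i j) (matrix_unit k l)) \<le> 1 \<longleftrightarrow> i \<noteq> k"
proof
  let ?x = "row_pair (matrix_unit i j) (matrix_unit k l)"
  show "mat_norm 2 ?x \<le> 1" if "i \<noteq> k"
  proof (rule mat_norm_leI)
    fix \<xi> assume \<xi>: "dsum_norm 2 \<xi> \<le> 1"
    have "dsum_norm 2 (mat_app 2 ?x \<xi>) = sqrt ((cmod (coord (\<xi> 0) j))\<^sup>2 + (cmod (coord (\<xi> 1) l))\<^sup>2)"
      by (simp add: dsum_norm_row_pair matrix_unit.rep_eq norm_two_basis_vecs[OF that])
    also have "\<dots> \<le> dsum_norm 2 \<xi>"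
      unfolding dsum_norm_2
      by (intro real_sqrt_le_mono add_mono power_mono coord_le_norm norm_ge_zero)
    finally show "dsum_norm 2 (mat_app 2 ?x \<xi>) \<le> 1" using \<xi> by simp
  qed
  show "i \<noteq> k" if "mat_norm 2 ?x \<le> 1"
  proof
    assume [simp]: "i = k"
    \<comment> \<open>\<open>(3/5, 4/5)\<close> is a rational unit vector, and \<open>3/5 + 4/5 > 1\<close>.\<close>
    define \<xi> where "\<xi> s = (if s = 0 then (3/5) *\<^sub>C basis_vec j else (4/5) *\<^sub>C basis_vec l)" for s :: nat
    have "dsum_norm 2 \<xi> = 1"
      by (simp add: dsum_norm_2 \<xi>_def scaleC_ell2_norm norm_basis_vec norm_divide power2_eq_square)
    then have "dsum_norm 2 (mat_app 2 ?x \<xi>) \<le> 1"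
      using dsum_norm_le_mat_norm[of 2 \<xi> ?x] that by simp
    moreover have "app (matrix_unit i j) (\<xi> 0) + app (matrix_unit k l) (\<xi> 1) = (7/5) *\<^sub>C basis_vec k"
      by (simp add: matrix_unit.rep_eq \<xi>_def scaleC_ell2.rep_eq basis_vec.rep_eq
          scaleC_add_left[symmetric])
    ultimately show False
      by (simp add: dsum_norm_row_pair scaleC_ell2_norm norm_basis_vec norm_divide)
  qed
qed

lemma mat_norm_col_units: "mat_norm 2 (col_pair (matrix_unit i j) (matrix_unit k l)) \<le> 1 \<longleftrightarrow> j \<noteq> l"
proof
  let ?x = "col_pair (matrix_unit i j) (matrix_unit k l)"
  have eq: "dsum_norm 2 (mat_app 2 ?x \<xi>)
      = sqrt ((cmod (coord (\<xi> 0) j))\<^sup>2 + (cmod (coord (\<xi> 0) l))\<^sup>2)" for \<xi>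
    by (simp add: dsum_norm_col_pair matrix_unit.rep_eq scaleC_ell2_norm norm_basis_vec)
  show "mat_norm 2 ?x \<le> 1" if "j \<noteq> l"
  proof (rule mat_norm_leI)
    fix \<xi> assume \<xi>: "dsum_norm 2 \<xi> \<le> 1"
    have "(cmod (coord (\<xi> 0) j))\<^sup>2 + (cmod (coord (\<xi> 0) l))\<^sup>2
        = (\<Sum>n\<in>{j, l}. (cmod (coord (\<xi> 0) n))\<^sup>2)"
      using that by simp
    also have "\<dots> \<le> (norm (\<xi> 0))\<^sup>2"
      unfolding norm_ell2_sq by (rule sum_le_suminf[OF summable_coord]) auto
    also have "\<dots> \<le> (norm (\<xi> 0))\<^sup>2 + (norm (\<xi> 1))\<^sup>2" by simp
    finally have "dsum_norm 2 (mat_app 2 ?x \<xi>) \<le> dsum_norm 2 \<xi>"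
      unfolding eq unfolding dsum_norm_2 by (rule real_sqrt_le_mono)
    then show "dsum_norm 2 (mat_app 2 ?x \<xi>) \<le> 1" using \<xi> by simp
  qed
  show "j \<noteq> l" if "mat_norm 2 ?x \<le> 1"
  proof
    assume jl: "j = l"
    define \<xi> where "\<xi> s = (if s = 0 then basis_vec j else 0)" for s :: nat
    have "dsum_norm 2 \<xi> = 1"
      by (simp add: dsum_norm_2 \<xi>_def norm_basis_vec)
    then have "dsum_norm 2 (mat_app 2 ?x \<xi>) \<le> 1"
      using dsum_norm_le_mat_norm[of 2 \<xi> ?x] that by simp
    then show False unfolding eq by (simp add: jl \<xi>_def basis_vec.rep_eq)
  qed
qed

lemma amplification_pairs:
  assumes "T 0 = 0"
  shows "amplification T (row_pair a b) = row_pair (T a) (T b)"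
    and "amplification T (col_pair a b) = col_pair (T a) (T b)"
  using assms by (simp_all add: amplification_def row_pair_def col_pair_def fun_eq_iff)

text \<open>For matrix units, having amplified norm at most \<open>1\<close> is the same as lying in different rows
  (or columns), and a complete contraction preserves such a bound.\<close>

lemma completely_contractive_separates_lines:
  assumes "completely_contractive T" "T 0 = 0"
    and "T (matrix_unit i j) = matrix_unit r c" "T (matrix_unit k l) = matrix_unit r' c'"
  shows "r = r' \<Longrightarrow> i = k" and "c = c' \<Longrightarrow> j = l"
proof -
  have "mat_norm 2 (amplification T x) \<le> mat_norm 2 x" for x
    using assms(1) by (simp add: completely_contractive_def)
  from this[of "row_pair (matrix_unit i j) (matrix_unit k l)"]
    this[of "col_pair (matrix_unit i j) (matrix_unit k l)"]
  show "r = r' \<Longrightarrow> i = k" and "c = c' \<Longrightarrow> j = l"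
    unfolding amplification_pairs[of T, OF assms(2)] assms(3,4)
    using mat_norm_row_units[of i j k l] mat_norm_row_units[of r c r' c']
      mat_norm_col_units[of i j k l] mat_norm_col_units[of r c r' c']
    by linarith+
qed

section \<open>Permutation unitaries\<close>

lemma sums_permute:
  fixes f :: "nat \<Rightarrow> 'a::banach"
  assumes "bij \<pi>" "summable (\<lambda>i. norm (f i))"
  shows "(\<lambda>i. f (\<pi> i)) sums (\<Sum>i. f i)"
proof -
  have "(f has_sum (\<Sum>i. f i)) UNIV"
    using assms(2) by (rule norm_summable_imp_has_sum) (rule summable_sums[OF summable_norm_cancel[OF assms(2)]])
  then have "((\<lambda>i. f (\<pi> i)) has_sum (\<Sum>i. f i)) UNIV"
    using has_sum_reindex_bij_betw[of \<pi> UNIV UNIV f] assms(1) by simp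
  then show ?thesis by (rule has_sum_imp_sums)
qed

text \<open>Precomposition with \<open>\<rho>\<close> sends \<open>e\<^sub>i\<close> to the basis vector with index \<open>\<rho>\<^sup>-\<^sup>1 i\<close>. It is unitary because
  the series defining the inner product converges absolutely and may be rearranged.\<close>

lemma permutation_unitary_exists:
  assumes "bij \<rho>"
  shows "\<exists>u. permutation_unitary u \<and> (\<forall>x i. coord (app u x) i = coord x (\<rho> i))"
proof -
  define g where "g x = Abs_ell2 (\<lambda>i. coord x (\<rho> i))" for x
  have sums: "(\<lambda>i. (cmod (coord x (\<rho> i)))\<^sup>2) sums (\<Sum>i. (cmod (coord x i))\<^sup>2)" for x
    using sums_permute[of \<rho> "\<lambda>i. (cmod (coord x i))\<^sup>2"] assms summable_coord[of x] by simp
  have g: "coord (g x) i = coord x (\<rho> i)" for x i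
    using sums[of x] by (simp add: g_def Abs_ell2_inverse sums_iff)
  have lin: "clinear g"
    by (auto simp: clinear_iff g plus_ell2.rep_eq scaleC_ell2.rep_eq intro!: ell2_eqI)
  have "(norm (g x))\<^sup>2 = (norm x)\<^sup>2" for x
    using sums[of x] by (simp add: norm_ell2_sq g sums_iff)
  then have "norm (g x) = norm x" for x by simp
  then have "bounded_linear g"
    using lin by (intro bounded_linear_intro[where K = 1]) (auto simp: clinear_iff scaleR_scaleC)
  with lin have app: "app (Abs_bop g) = g" by (simp add: Abs_bop_inverse)
  have basis: "g (basis_vec (\<rho> i)) = basis_vec i" for i
    using assms by (intro ell2_eqI) (simp add: g basis_vec.rep_eq bij_is_inj inj_eq)
  have "cinner (g x) (g y) = cinner x y" for x y
  proof -
    have "summable (\<lambda>i. cmod (coord x i * cnj (coord y i)))"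
      by (simp add: norm_mult summable_sq_prod summable_coord)
    then show ?thesis
      using sums_permute[OF assms, of "\<lambda>i. coord x i * cnj (coord y i)"]
      by (simp add: cinner_def g sums_iff)
  qed
  moreover have "surj g"
  proof (rule surjI)
    fix y
    have inv: "bij (inv \<rho>)" using assms by (rule bij_imp_bij_inv)
    have "summable (\<lambda>i. (cmod (coord y (inv \<rho> i)))\<^sup>2)"
      using sums_permute[OF inv, of "\<lambda>i. (cmod (coord y i))\<^sup>2"] summable_coord[of y]
      by (simp add: sums_iff)
    then have "coord (Abs_ell2 (\<lambda>i. coord y (inv \<rho> i))) i = coord y (inv \<rho> i)" for i
      by (simp add: Abs_ell2_inverse)
    then show "g (Abs_ell2 (\<lambda>i. coord y (inv \<rho> i))) = y"
      using assms by (intro ell2_eqI) (simp add: g bij_is_inj)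
  qed
  ultimately have "unitary (Abs_bop g)" by (simp add: unitary_def app)
  moreover have "g (basis_vec i) = basis_vec (inv \<rho> i)" for i
    using basis[of "inv \<rho> i"] assms by (simp add: bij_is_surj surj_f_inv_f)
  ultimately have "permutation_unitary (Abs_bop g)"
    unfolding permutation_unitary_def app using bij_imp_bij_inv[OF assms] by blast
  then show ?thesis using g app by auto
qed

lemma unitary_norm:
  assumes "unitary u"
  shows "norm (app u x) = norm x"
proof -
  have "complex_of_real ((norm (app u x))\<^sup>2) = complex_of_real ((norm x)\<^sup>2)"
    using assms unfolding cinner_self[symmetric] by (simp add: unitary_def)
  then have "(norm (app u x))\<^sup>2 = (norm x)\<^sup>2" using of_real_eq_iff by blast
  then show ?thesis by simp
qed

text \<open>A coordinate is an inner product with a basis vector, and \<open>u\<close> preserves inner products, so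
  the action on the basis determines all of \<open>u\<close> without an appeal to continuity.\<close>

lemma coord_permutation_unitary:
  assumes "unitary u" "\<And>i. app u (basis_vec i) = basis_vec (\<pi> i)"
  shows "coord (app u y) (\<pi> i) = coord y i"
proof -
  have "cinner (app u y) (app u (basis_vec i)) = cinner y (basis_vec i)"
    using assms(1) by (simp add: unitary_def)
  then show ?thesis by (simp add: assms(2) cinner_basis_vec)
qed

section \<open>Multiplication by unitaries on both sides\<close>

text \<open>The unitary \<open>v\<close> maps the unit ball of the direct sum onto itself, and \<open>u\<close> does not change the
  norms of the values.\<close>

lemma complete_isometry_unitary:
  assumes "unitary u" "unitary v"
  shows "complete_isometry (\<lambda>a. u \<cdot> a \<cdot> v)"
proof -
  have "mat_norm k (amplification (\<lambda>a. u \<cdot> a \<cdot> v) x) = mat_norm k x" for k x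
  proof -
    let ?y = "amplification (\<lambda>a. u \<cdot> a \<cdot> v) x"
    have val: "mat_app k ?y \<xi> r = app u (mat_app k x (app v \<circ> \<xi>) r)" for \<xi> r
      by (simp add: mat_app_def amplification_def bop_comp.rep_eq
          linear_sum[OF bounded_linear.linear[OF app_bounded_linear]])
    have eq: "dsum_norm k (mat_app k ?y \<xi>) = dsum_norm k (mat_app k x (app v \<circ> \<xi>))" for \<xi>
      by (simp add: dsum_norm_def val unitary_norm[OF assms(1)])
    have ball: "dsum_norm k (app v \<circ> \<xi>) = dsum_norm k \<xi>" for \<xi>
      by (simp add: dsum_norm_def unitary_norm[OF assms(2)])
    have "mat_norm k ?y \<le> mat_norm k x"
      by (rule mat_norm_leI) (metis eq ball dsum_norm_le_mat_norm)
    moreover have "mat_norm k x \<le> mat_norm k ?y"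
    proof (rule mat_norm_leI)
      fix \<xi> assume "dsum_norm k \<xi> \<le> 1"
      moreover have "app v \<circ> (\<lambda>s. inv (app v) (\<xi> s)) = \<xi>"
        using assms(2) by (auto simp: unitary_def surj_f_inv_f)
      ultimately show "dsum_norm k (mat_app k x \<xi>) \<le> mat_norm k ?y"
        by (metis eq ball dsum_norm_le_mat_norm)
    qed
    ultimately show ?thesis by simp
  qed
  then show ?thesis by (simp add: complete_isometry_def)
qed

lemma schur_multiplicative_permutation_unitary:
  assumes "permutation_unitary u" "permutation_unitary v"
  shows "schur_multiplicative (\<lambda>a. u \<cdot> a \<cdot> v)"
proof -
  obtain \<pi> where u: "unitary u" and \<pi>: "bij \<pi>" "\<And>i. app u (basis_vec i) = basis_vec (\<pi> i)"
    using assms(1) by (auto simp: permutation_unitary_def)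
  obtain \<theta> where \<theta>: "\<And>i. app v (basis_vec i) = basis_vec (\<theta> i)"
    using assms(2) by (auto simp: permutation_unitary_def)
  have entry: "entry (u \<cdot> a \<cdot> v) (\<pi> i) j = entry a i (\<theta> j)" for a i j
    by (simp add: entry_coord bop_comp.rep_eq \<theta> coord_permutation_unitary[OF u \<pi>(2)])
  have "(u \<cdot> a \<cdot> v) \<star> (u \<cdot> b \<cdot> v) = u \<cdot> (a \<star> b) \<cdot> v" for a b
  proof (rule bop_eqI)
    fix r j
    obtain i where "r = \<pi> i" using \<pi>(1) by (metis bij_pointE)
    then show "entry ((u \<cdot> a \<cdot> v) \<star> (u \<cdot> b \<cdot> v)) r j = entry (u \<cdot> (a \<star> b) \<cdot> v) r j"
      by (simp add: entry_schur entry)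
  qed
  then show ?thesis by (simp add: schur_multiplicative_def)
qed

section \<open>The characterisation\<close>

lemma bij_product_factors:
  assumes "bij (\<lambda>(r, c). (\<rho> r, \<kappa> c))"
  shows "bij \<rho>" "bij \<kappa>"
proof -
  have inj: "r = r' \<and> c = c'" if "\<rho> r = \<rho> r'" "\<kappa> c = \<kappa> c'" for r r' c c'
    using that injD[OF bij_is_inj[OF assms], of "(r, c)" "(r', c')"] by simp
  have surj: "\<exists>r c. \<rho> r = y \<and> \<kappa> c = z" for y z
    using surjD[OF bij_is_surj[OF assms], of "(y, z)"] by auto
  show "bij \<rho>" "bij \<kappa>"
    unfolding bij_def inj_def surj_def using inj surj by metis+
qed

lemma completely_contractive_schur_automorphism:
  assumes "clinear T" "bij T" "completely_contractive T" "schur_multiplicative T"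
  obtains u v where "permutation_unitary u" "permutation_unitary v" "\<And>a. T a = u \<cdot> a \<cdot> v"
proof -
  have "T (0 *\<^sub>C 0) = 0 *\<^sub>C T 0" using assms(1) unfolding clinear_iff by blast
  moreover have "0 *\<^sub>C a = 0" for a :: bop
    by (rule bop_eqI) (simp add: entry_scaleC entry_zero)
  ultimately have T0: "T 0 = 0" by simp
  obtain \<sigma> where \<sigma>: "bij \<sigma>"
    and unit: "\<And>i j. T (matrix_unit i j) = case_prod matrix_unit (\<sigma> (i, j))"
    and entries: "\<And>a i j. case_prod (entry (T a)) (\<sigma> (i, j)) = entry a i j"
    using schur_automorphism_permutes_units[OF assms(1,2,4)] by blast
  define \<tau> where "\<tau> = inv \<sigma>"
  have \<tau>: "bij \<tau>" unfolding \<tau>_def using \<sigma> by (rule bij_imp_bij_inv)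
  have \<sigma>\<tau>: "\<sigma> (\<tau> x) = x" for x using \<sigma> by (simp add: \<tau>_def bij_is_surj surj_f_inv_f)
  have unit': "T (matrix_unit (fst (\<tau> (r, c))) (snd (\<tau> (r, c)))) = matrix_unit r c" for r c
    by (simp add: unit \<sigma>\<tau>)
  \<comment> \<open>The column index \<open>0\<close> in \<open>\<rho>\<close> and the row index \<open>0\<close> in \<open>\<kappa>\<close> are arbitrary.\<close>
  define \<rho> where "\<rho> r = fst (\<tau> (r, 0))" for r
  define \<kappa> where "\<kappa> c = snd (\<tau> (0, c))" for c
  note lines = completely_contractive_separates_lines[OF assms(3) T0 unit' unit']
  have \<tau>_eq: "\<tau> (r, c) = (\<rho> r, \<kappa> c)" for r c
    using lines(1)[of r r c 0] lines(2)[of c c r 0] by (simp add: \<rho>_def \<kappa>_def prod_eq_iff)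
  then have "\<tau> = (\<lambda>(r, c). (\<rho> r, \<kappa> c))" by auto
  with \<tau> have \<rho>: "bij \<rho>" and \<kappa>: "bij \<kappa>" using bij_product_factors[of \<rho> \<kappa>] by simp_all
  have entry_T: "entry (T a) r c = entry a (\<rho> r) (\<kappa> c)" for a r c
    using entries[of a "\<rho> r" "\<kappa> c"] \<sigma>\<tau>[of "(r, c)"] by (simp add: \<tau>_eq)
  obtain u where u: "permutation_unitary u" "\<And>x i. coord (app u x) i = coord x (\<rho> i)"
    using permutation_unitary_exists[OF \<rho>] by blast
  obtain v where v: "permutation_unitary v" "\<And>x i. coord (app v x) i = coord x (inv \<kappa> i)"
    using permutation_unitary_exists[OF bij_imp_bij_inv[OF \<kappa>]] by blast
  have "app v (basis_vec c) = basis_vec (\<kappa> c)" for c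
    by (rule ell2_eqI) (use bij_inv_eq_iff[OF \<kappa>] in \<open>simp add: v(2) basis_vec.rep_eq; metis\<close>)
  then have "T a = u \<cdot> a \<cdot> v" for a
    by (intro bop_eqI, simp only: entry_T) (simp add: entry_coord bop_comp.rep_eq u(2))
  with u(1) v(1) show ?thesis by (rule that)
qed

theorem corollary2p6:
  fixes T :: "bop \<Rightarrow> bop"
  assumes "clinear T" and "bij T"
  shows "(completely_contractive T \<and> schur_multiplicative T \<longleftrightarrow>
           (\<exists>u v. permutation_unitary u \<and> permutation_unitary v \<and> (\<forall>a. T a = u \<cdot> a \<cdot> v)))
       \<and> (completely_contractive T \<and> schur_multiplicative T \<longrightarrow> complete_isometry T)"
proof -
  have forward: "\<exists>u v. permutation_unitary u \<and> permutation_unitary v \<and> (\<forall>a. T a = u \<cdot> a \<cdot> v)"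
    if "completely_contractive T \<and> schur_multiplicative T"
    using completely_contractive_schur_automorphism[OF assms] that by blast
  have backward: "complete_isometry T \<and> schur_multiplicative T"
    if uv: "permutation_unitary u" "permutation_unitary v" "\<forall>a. T a = u \<cdot> a \<cdot> v" for u v
  proof -
    have "T = (\<lambda>a. u \<cdot> a \<cdot> v)" using uv(3) by auto
    then show ?thesis
      using complete_isometry_unitary[of u v] schur_multiplicative_permutation_unitary[OF uv(1,2)] uv(1,2)
      by (simp add: permutation_unitary_def)
  qed
  have "completely_contractive T" if "complete_isometry T"
    using that by (simp add: complete_isometry_def completely_contractive_def)
  then show ?thesis using forward backward by blast
qed

end
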